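(* Let $a:S^1\times[0,T)\to\mathbb{R}$ be a strictly positive smooth function, $\pi$-periodic in $\theta$ for each fixed $t$, with $a+a''>0$ everywhere, and assume that $t\mapsto a(\theta,t)+a''(\theta,t)$ is nondecreasing for each $\theta\in S^1$. Let $T_0\le T$ and let $k:S^1\times[0,T_0)\to\mathbb{R}$ be a function with $k\in C^{2+\alpha,1+\alpha}(S^1\times[0,T_0-\epsilon])$ for all $\epsilon>0$, satisfying $$\frac{\partial k}{\partial t}=\frac{a}{a+a''}k^2k''+\frac{2a'}{a+a''}k^2k'+k^3+\frac{\partial\log(a+a'')}{\partial t}k$$ with initial condition $k(\theta,0)=\varphi(\theta)$, where $\varphi$ is a strictly positive $C^{1+\alpha}$ function on $S^1$ such that $$\int_0^{2\pi}\frac{a(\theta,0)+a''(\theta,0)}{\varphi(\theta)}\sin\theta\,d\theta=\int_0^{2\pi}\frac{a(\theta,0)+a''(\theta,0)}{\varphi(\theta)}\cos\theta\,d\theta=0.$$ Then the family of curves with parameter $t\in[0,T_0)$ $$F(\theta,t)=\Big(-\int_0^{\theta}\frac{a(\sigma,t)+a''(\sigma,t)}{k(\sigma,t)}\sin\sigma\,d\sigma-\int_0^t a(0,s)k(0,s)\,ds,\ \ \int_0^{\theta}\frac{a(\sigma,t)+a''(\sigma,t)}{k(\sigma,t)}\cos\sigma\,d\sigma-\int_0^t \big(a(0,s)k'(0,s)+a'(0,s)k(0,s)\big)\,ds\Big)$$ is well defined, and the following hold: (a) for each fixed $t$, the map $\theta\mapsto F(\theta,t)$ is a simple, closed and strictly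 convex curve, parameterized as usual, whose $t$-minkowskian curvature is given by $\theta\mapsto k(\theta,t)$; (b) $\displaystyle\frac{\partial F}{\partial t}(\theta,t)=-k(\theta,t)\,p(\theta,t)-a(\theta,t)^2k'(\theta,t)\,q(\theta,t).$
   Context: $S^1=\mathbb{R}/2\pi\mathbb{Z}$. Primes denote derivatives in $\theta$. $[x,y]$ denotes the determinant of the pair of vectors $x,y\in\mathbb{R}^2$. Let $e_r=(\cos\theta,\sin\theta)$, $e_\theta=(-\sin\theta,\cos\theta)$. $C^{2+\alpha,1+\alpha}$ and $C^{1+\alpha}$ are the usual (space, time) Hölder classes for a Hölder exponent $\alpha$. For each $t$, the curve $p(\theta,t)=a(\theta,t)e_r+a'(\theta,t)e_\theta$ bounds the unit ball $\mathcal{P}_t$ of a norm on $\mathbb{R}^2$, and the boundary of the dual ball $\mathcal{Q}_t$ is parameterized by $q(\theta,t)=\dfrac{p'(\theta,t)}{[p(\theta,t),p'(\theta,t)]}$ (so $q=e_\theta/a$). A strictly convex closed curve $\gamma(\theta)$ is "parameterized as usual" if $\theta+\pi/2$ is the angle between $\gamma'(\theta)$ and the $x$-axis. Then, for fixed $t$, $\gamma'(\theta)=\lambda(\theta)q(\theta,t)$ with $\lambda>0$, and the $t$-minkowskian curvature of $\gamma$ (the minkowskian curvature with respect to the $\mathcal{P}_t$-norm) at parameter $\theta$ is $\dfrac{[p(\theta,t),p'(\theta,t)]}{\lambda(\theta)}$. *)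

theory Defs
  imports "HOL-Analysis.Analysis"
begin

text \<open>
  Functions on \<open>S\<^sup>1 \<times> I\<close> are curried functions of a real angle and a real time that are
  \<open>2\<pi>\<close>-periodic in the angle for every time in \<open>I\<close>; values at times outside \<open>I\<close> are irrelevant.
  The end point of a time interval is an extended real, so that \<open>[0,\<infinity>)\<close> is allowed.
\<close>

definition time_interval :: "ereal \<Rightarrow> real set" where
  "time_interval T = {t. 0 \<le> t \<and> ereal t < T}"

definition dtheta :: "(real \<Rightarrow> real \<Rightarrow> real) \<Rightarrow> real \<Rightarrow> real \<Rightarrow> real" where
  "dtheta f \<theta> t = deriv (\<lambda>x. f x t) \<theta>"

text \<open>The time derivative is taken within \<open>I\<close>, hence is one-sided at an end point of \<open>I\<close>.\<close>

definition dtime :: "real set \<Rightarrow> (real \<Rightarrow> real \<Rightarrow> real) \<Rightarrow> real \<Rightarrow> real \<Rightarrow> real" where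
  "dtime I f \<theta> t = vector_derivative (\<lambda>s. f \<theta> s) (at t within I)"

text \<open>\<open>C_on n I f\<close>: all iterated partial derivatives of \<open>f\<close> of order at most \<open>n\<close> exist and are
  continuous on \<open>\<real> \<times> I\<close>.\<close>

primrec C_on :: "nat \<Rightarrow> real set \<Rightarrow> (real \<Rightarrow> real \<Rightarrow> real) \<Rightarrow> bool" where
  "C_on 0 I f \<longleftrightarrow> continuous_on (UNIV \<times> I) (\<lambda>(\<theta>, t). f \<theta> t)"
| "C_on (Suc n) I f \<longleftrightarrow>
     continuous_on (UNIV \<times> I) (\<lambda>(\<theta>, t). f \<theta> t) \<and>
     (\<forall>\<theta>. \<forall>t\<in>I. (\<lambda>x. f x t) differentiable (at \<theta>) \<and> (\<lambda>s. f \<theta> s) differentiable (at t within I)) \<and>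
     C_on n I (dtheta f) \<and> C_on n I (dtime I f)"

definition smooth_on_time :: "real set \<Rightarrow> (real \<Rightarrow> real \<Rightarrow> real) \<Rightarrow> bool" where
  "smooth_on_time I f \<longleftrightarrow> (\<forall>n. C_on n I f)"

text \<open>The class \<open>C\<^sup>1\<^sup>+\<^sup>\<alpha>\<close>. For periodic functions a Hoelder bound on the real line is the same as
  a Hoelder bound with respect to the distance of the circle.\<close>

definition holder_C1 :: "real \<Rightarrow> (real \<Rightarrow> real) \<Rightarrow> bool" where
  "holder_C1 \<alpha> f \<longleftrightarrow>
     (\<forall>x. f differentiable (at x)) \<and>
     (\<exists>C. \<forall>x y. \<bar>deriv f x - deriv f y\<bar> \<le> C * \<bar>x - y\<bar> powr \<alpha>)"

text \<open>The (space, time) class \<open>C\<^sup>2\<^sup>+\<^sup>\<alpha>\<^sup>,\<^sup>1\<^sup>+\<^sup>\<alpha>\<close> on \<open>S\<^sup>1 \<times> I\<close> for a compact interval \<open>I\<close>: the partial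
  derivatives of order up to two in the angle and up to one in time are continuous, the second
  angular derivative is \<open>\<alpha>\<close>-Hoelder in the angle uniformly in time, and the time derivative is
  \<open>\<alpha>\<close>-Hoelder in time uniformly in the angle. Variants that also ask for mixed Hoelder bounds
  define subclasses.\<close>

definition holder_C2_C1 :: "real \<Rightarrow> real set \<Rightarrow> (real \<Rightarrow> real \<Rightarrow> real) \<Rightarrow> bool" where
  "holder_C2_C1 \<alpha> I f \<longleftrightarrow>
     (\<forall>\<theta>. \<forall>t\<in>I. (\<lambda>x. f x t) differentiable (at \<theta>) \<and> (\<lambda>x. dtheta f x t) differentiable (at \<theta>) \<and>
        (\<lambda>s. f \<theta> s) differentiable (at t within I)) \<and>
     continuous_on (UNIV \<times> I) (\<lambda>(\<theta>, t). f \<theta> t) \<and>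
     continuous_on (UNIV \<times> I) (\<lambda>(\<theta>, t). dtheta f \<theta> t) \<and>
     continuous_on (UNIV \<times> I) (\<lambda>(\<theta>, t). dtheta (dtheta f) \<theta> t) \<and>
     continuous_on (UNIV \<times> I) (\<lambda>(\<theta>, t). dtime I f \<theta> t) \<and>
     (\<exists>C. \<forall>t\<in>I. \<forall>x y.
        \<bar>dtheta (dtheta f) x t - dtheta (dtheta f) y t\<bar> \<le> C * \<bar>x - y\<bar> powr \<alpha>) \<and>
     (\<exists>C. \<forall>\<theta>. \<forall>s\<in>I. \<forall>t\<in>I.
        \<bar>dtime I f \<theta> s - dtime I f \<theta> t\<bar> \<le> C * \<bar>s - t\<bar> powr \<alpha>)"

definition bracket :: "real ^ 2 \<Rightarrow> real ^ 2 \<Rightarrow> real" where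
  "bracket x y = det (vector [x, y] :: real ^ 2 ^ 2)"

definition e_r :: "real \<Rightarrow> real ^ 2" where
  "e_r \<theta> = vector [cos \<theta>, sin \<theta>]"

definition e_theta :: "real \<Rightarrow> real ^ 2" where
  "e_theta \<theta> = vector [- sin \<theta>, cos \<theta>]"

definition p_curve :: "(real \<Rightarrow> real \<Rightarrow> real) \<Rightarrow> real \<Rightarrow> real \<Rightarrow> real ^ 2" where
  "p_curve a \<theta> t = a \<theta> t *\<^sub>R e_r \<theta> + dtheta a \<theta> t *\<^sub>R e_theta \<theta>"

definition p_deriv :: "(real \<Rightarrow> real \<Rightarrow> real) \<Rightarrow> real \<Rightarrow> real \<Rightarrow> real ^ 2" where
  "p_deriv a \<theta> t = vector_derivative (\<lambda>x. p_curve a x t) (at \<theta>)"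

definition q_curve :: "(real \<Rightarrow> real \<Rightarrow> real) \<Rightarrow> real \<Rightarrow> real \<Rightarrow> real ^ 2" where
  "q_curve a \<theta> t = (1 / bracket (p_curve a \<theta> t) (p_deriv a \<theta> t)) *\<^sub>R p_deriv a \<theta> t"

text \<open>Closed curves are \<open>2\<pi>\<close>-periodic maps from the real line to the plane.\<close>

definition closed_curve :: "(real \<Rightarrow> real ^ 2) \<Rightarrow> bool" where
  "closed_curve \<gamma> \<longleftrightarrow> continuous_on UNIV \<gamma> \<and> (\<forall>\<theta>. \<gamma> (\<theta> + 2 * pi) = \<gamma> \<theta>)"

definition simple_closed_curve :: "(real \<Rightarrow> real ^ 2) \<Rightarrow> bool" where
  "simple_closed_curve \<gamma> \<longleftrightarrow> closed_curve \<gamma> \<and> inj_on \<gamma> {0..<2 * pi}"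

definition strictly_convex_body :: "(real ^ 2) set \<Rightarrow> bool" where
  "strictly_convex_body K \<longleftrightarrow>
     compact K \<and> convex K \<and> interior K \<noteq> {} \<and>
     (\<forall>x\<in>K. \<forall>y\<in>K. x \<noteq> y \<longrightarrow> open_segment x y \<subseteq> interior K)"

definition strictly_convex_curve :: "(real \<Rightarrow> real ^ 2) \<Rightarrow> bool" where
  "strictly_convex_curve \<gamma> \<longleftrightarrow> (\<exists>K. strictly_convex_body K \<and> range \<gamma> = frontier K)"

text \<open>The tangent vector at \<open>\<theta>\<close> makes the angle \<open>\<theta> + \<pi>/2\<close> with the \<open>x\<close>-axis.\<close>

definition parameterized_as_usual :: "(real \<Rightarrow> real ^ 2) \<Rightarrow> bool" where
  "parameterized_as_usual \<gamma> \<longleftrightarrow>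
     (\<forall>\<theta>. \<exists>r>0. (\<gamma> has_vector_derivative
        r *\<^sub>R vector [cos (\<theta> + pi / 2), sin (\<theta> + pi / 2)]) (at \<theta>))"

text \<open>\<open>has_minkowskian_curvature a t \<gamma> \<theta> \<kappa>\<close>: the curve \<open>\<gamma>\<close>, parameterized as usual, has
  \<open>t\<close>-minkowskian curvature \<open>\<kappa>\<close> at the parameter \<open>\<theta>\<close>.\<close>

definition has_minkowskian_curvature ::
    "(real \<Rightarrow> real \<Rightarrow> real) \<Rightarrow> real \<Rightarrow> (real \<Rightarrow> real ^ 2) \<Rightarrow> real \<Rightarrow> real \<Rightarrow> bool" where
  "has_minkowskian_curvature a t \<gamma> \<theta> \<kappa> \<longleftrightarrow>
     (\<exists>l>0. (\<gamma> has_vector_derivative l *\<^sub>R q_curve a \<theta> t) (at \<theta>) \<and>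
        \<kappa> = bracket (p_curve a \<theta> t) (p_deriv a \<theta> t) / l)"

text \<open>The interval integrals are oriented, so negative angles are covered.\<close>

definition F_curve ::
    "(real \<Rightarrow> real \<Rightarrow> real) \<Rightarrow> (real \<Rightarrow> real \<Rightarrow> real) \<Rightarrow> real \<Rightarrow> real \<Rightarrow> real ^ 2" where
  "F_curve a k \<theta> t = vector
     [- (LBINT \<sigma>=ereal 0..ereal \<theta>. (a \<sigma> t + dtheta (dtheta a) \<sigma> t) / k \<sigma> t * sin \<sigma>)
        - (LBINT s=ereal 0..ereal t. a 0 s * k 0 s),
      (LBINT \<sigma>=ereal 0..ereal \<theta>. (a \<sigma> t + dtheta (dtheta a) \<sigma> t) / k \<sigma> t * cos \<sigma>)
        - (LBINT s=ereal 0..ereal t. a 0 s * dtheta k 0 s + dtheta a 0 s * k 0 s)]"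

text \<open>The formula for \<open>F\<close> makes sense at every point of \<open>S\<^sup>1 \<times> {t}\<close>: no denominator vanishes, all
  integrals exist, and the value depends on the angle only modulo \<open>2\<pi>\<close>. The first
  conjunct is needed since division by zero is total.\<close>

definition F_well_defined ::
    "(real \<Rightarrow> real \<Rightarrow> real) \<Rightarrow> (real \<Rightarrow> real \<Rightarrow> real) \<Rightarrow> real \<Rightarrow> bool" where
  "F_well_defined a k t \<longleftrightarrow>
     (\<forall>\<theta>. k \<theta> t \<noteq> 0) \<and>
     (\<forall>\<theta>. interval_lebesgue_integrable lborel (ereal 0) (ereal \<theta>)
             (\<lambda>\<sigma>. (a \<sigma> t + dtheta (dtheta a) \<sigma> t) / k \<sigma> t * sin \<sigma>)) \<and>
     (\<forall>\<theta>. interval_lebesgue_integrable lborel (ereal 0) (ereal \<theta>)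
             (\<lambda>\<sigma>. (a \<sigma> t + dtheta (dtheta a) \<sigma> t) / k \<sigma> t * cos \<sigma>)) \<and>
     interval_lebesgue_integrable lborel (ereal 0) (ereal t) (\<lambda>s. a 0 s * k 0 s) \<and>
     interval_lebesgue_integrable lborel (ereal 0) (ereal t)
       (\<lambda>s. a 0 s * dtheta k 0 s + dtheta a 0 s * k 0 s) \<and>
     (\<forall>\<theta>. F_curve a k (\<theta> + 2 * pi) t = F_curve a k \<theta> t)"

end

theory Submission
  imports Defs "HOL-Library.Periodic_Fun"
begin

text \<open>
  Write \<open>h = a k\<close>. The first point is that \<open>k\<close> stays positive. At a spatial minimum of \<open>k\<close> the
  equation gives a time derivative of at least \<open>k\<^sup>3\<close> plus a multiple of \<open>k\<close> that is nonnegative because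
  \<open>a + a''\<close> is nondecreasing in time; so \<open>k\<close> can never come down to a positive level below its
  initial values (lemmas \<open>lower_barrier\<close> and \<open>evolution_keeps_lower_bound\<close>).

  The second point is that the equation for \<open>k\<close> simplifies when it is written for the euclidean
  curvature radius \<open>\<rho> = (a + a'') / k\<close>: it becomes \<open>\<rho>\<^sub>t = - (h'' + h)\<close>. Multiplied by \<open>sin\<close> or \<open>cos\<close>, the
  right-hand side is an exact derivative in the angle, so the time derivative of the integrals that
  define the curve can be computed in closed form (lemma \<open>weighted_radius_deriv_time\<close>). Over a full
  period this time derivative vanishes, hence the curves stay closed. Over \<open>[0, \<theta>]\<close> it yields
  \<open>F\<^sub>t = - h e\<^sub>r - h' e\<^sub>\<theta>\<close>, which is the asserted velocity since \<open>p = a e\<^sub>r + a' e\<^sub>\<theta>\<close> and \<open>q = e\<^sub>\<theta> / a\<close>.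

  Finally \<open>F\<close> has the derivative \<open>\<rho> e\<^sub>\<theta>\<close> in the angle, with \<open>\<rho> > 0\<close>. A closed curve of this kind has
  exactly one highest point in every direction, namely the one whose parameter is the angle of this
  direction. That makes it simple, and the boundary of a strictly convex body, its convex hull
  (theorem \<open>strictly_convex_curve_of_normal_angle\<close>). The curvature is read off from the derivative.
\<close>

section \<open>Vectors in the plane\<close>

lemma e_r_nth [simp]: "e_r \<theta> $ 1 = cos \<theta>" "e_r \<theta> $ 2 = sin \<theta>"
  by (simp_all add: e_r_def)

lemma e_theta_nth [simp]: "e_theta \<theta> $ 1 = - sin \<theta>" "e_theta \<theta> $ 2 = cos \<theta>"
  by (simp_all add: e_theta_def)

lemma vec2_eq_iff: "x = y \<longleftrightarrow> x $ 1 = y $ 1 \<and> x $ 2 = (y $ 2 :: 'a)" for x y :: "'a ^ 2"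
  by (simp add: vec_eq_iff forall_2)

lemma has_vector_derivative_vec2_iff:
  fixes f :: "real \<Rightarrow> real ^ 2"
  shows "(f has_vector_derivative d) (at x within S) \<longleftrightarrow>
    ((\<lambda>x. f x $ 1) has_real_derivative d $ 1) (at x within S) \<and>
    ((\<lambda>x. f x $ 2) has_real_derivative d $ 2) (at x within S)"
proof -
  have "(f has_vector_derivative d) (at x within S) \<longleftrightarrow>
      (\<forall>i. ((\<lambda>x. f x $ i) has_vector_derivative d $ i) (at x within S))"
    unfolding has_vector_derivative_def
    by (subst has_derivative_componentwise_within) (auto simp: Basis_vec_def inner_axis)
  then show ?thesis
    by (simp add: forall_2 has_real_derivative_iff_has_vector_derivative)
qed

lemma inner_e_theta_e_r: "e_theta \<sigma> \<bullet> e_r \<theta> = sin (\<theta> - \<sigma>)"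
  by (simp add: inner_vec_def sum_2 sin_diff)

lemma norm_e_r [simp]: "norm (e_r \<theta>) = 1"
  by (simp add: norm_eq_1 inner_vec_def sum_2 flip: power2_eq_square)

lemma polar_direction:
  fixes n :: "real ^ 2"
  assumes "n \<noteq> 0"
  obtains r \<theta> where "r > 0" "n = r *\<^sub>R e_r \<theta>"
proof -
  have n: "norm n \<noteq> 0" using assms by simp
  have eq: "(norm n)\<^sup>2 = (n $ 1)\<^sup>2 + (n $ 2)\<^sup>2"
    unfolding power2_norm_eq_inner by (simp only: inner_vec_def sum_2 power2_eq_square inner_real_def)
  have "(n $ 1 / norm n)\<^sup>2 + (n $ 2 / norm n)\<^sup>2 = ((n $ 1)\<^sup>2 + (n $ 2)\<^sup>2) / (norm n)\<^sup>2"
    by (simp only: power_divide add_divide_distrib)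
  also have "\<dots> = 1"
    unfolding eq[symmetric] using n by simp
  finally obtain t where "n $ 1 / norm n = cos t" "n $ 2 / norm n = sin t"
    by (rule sincos_total_2pi)
  then have "n $ 1 = norm n * cos t" "n $ 2 = norm n * sin t"
    using n by (metis nonzero_mult_div_cancel_left times_divide_eq_right)+
  then have "n = norm n *\<^sub>R e_r t"
    unfolding vec2_eq_iff by simp
  moreover have "norm n > 0" using assms by simp
  ultimately show thesis using that by blast
qed

lemma bracket_eq: "bracket x y = x $ 1 * y $ 2 - x $ 2 * y $ 1"
  by (simp add: bracket_def det_2)

section \<open>Strictly convex curves parameterized by their normal angle\<close>

lemma periodic_representative:
  fixes f :: "real \<Rightarrow> 'a"
  assumes "P > 0" and "\<And>x. f (x + P) = f x"
  shows "\<exists>y. z \<le> y \<and> y \<le> z + P \<and> f y = f x"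
proof -
  interpret periodic_fun_simple f P
    by unfold_locales (rule assms)
  define m where "m = \<lfloor>(x - z) / P\<rfloor>"
  have "of_int m \<le> (x - z) / P" "(x - z) / P \<le> of_int m + 1"
    unfolding m_def by linarith+
  then have "of_int m * P \<le> x - z" "x - z \<le> (of_int m + 1) * P"
    using \<open>P > 0\<close> by (simp_all add: pos_le_divide_eq pos_divide_le_eq)
  moreover have "f (x - of_int m * P) = f x" by (rule minus_of_int)
  ultimately show ?thesis
    by (intro exI[of _ "x - of_int m * P"]) (auto simp: algebra_simps)
qed

text \<open>
Adding \<open>x\<close> to the open half space below it leaves a convex set, so this set contains the convex
hull as soon as it contains \<open>S\<close>.
\<close>

lemma convex_hull_unique_maximum:
  fixes S :: "'a::real_inner set"
  assumes "\<And>y. y \<in> S \<Longrightarrow> y \<noteq> x \<Longrightarrow> n \<bullet> y < n \<bullet> x"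
    and "z \<in> convex hull S" and "z \<noteq> x"
  shows "n \<bullet> z < n \<bullet> x"
proof -
  let ?H = "insert x {y. n \<bullet> y < n \<bullet> x}"
  have "convex ?H"
  proof (rule convexI)
    fix y z u v assume y: "y \<in> ?H" and z: "z \<in> ?H" and uv: "0 \<le> u" "0 \<le> v" "u + v = (1::real)"
    consider "y = x" "z = x" | "u = 0" | "v = 0"
      | "u > 0" "v > 0" "n \<bullet> y < n \<bullet> x" "n \<bullet> z \<le> n \<bullet> x"
      | "u > 0" "v > 0" "n \<bullet> y \<le> n \<bullet> x" "n \<bullet> z < n \<bullet> x"
      using y z uv by fastforce
    then show "u *\<^sub>R y + v *\<^sub>R z \<in> ?H"
    proof cases
      case 1 then show ?thesis using uv by (simp flip: scaleR_add_left)
    next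
      case 4
      then have "u * (n \<bullet> y) + v * (n \<bullet> z) < u * (n \<bullet> x) + v * (n \<bullet> x)"
        by (intro add_less_le_mono mult_strict_left_mono mult_left_mono) auto
      then show ?thesis using uv by (simp add: inner_add_right flip: distrib_right)
    next
      case 5
      then have "u * (n \<bullet> y) + v * (n \<bullet> z) < u * (n \<bullet> x) + v * (n \<bullet> x)"
        by (intro add_le_less_mono mult_strict_left_mono mult_left_mono) auto
      then show ?thesis using uv by (simp add: inner_add_right flip: distrib_right)
    qed (use y z uv in auto)
  qed
  moreover have "S \<subseteq> ?H" using assms(1) by blast
  ultimately have "convex hull S \<subseteq> ?H" by (simp add: hull_minimal)
  then show ?thesis using assms by blast
qed

text \<open>
Unlike the statement for the relative boundary, this one also covers degenerate convex sets: if the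
interior is empty, the normal of a hyperplane that contains \<open>K\<close> serves.
\<close>

lemma convex_support_direction:
  fixes K :: "'a::euclidean_space set"
  assumes "convex K" "z \<in> K" "z \<notin> interior K"
  obtains n where "n \<noteq> 0" "\<And>y. y \<in> K \<Longrightarrow> n \<bullet> y \<le> n \<bullet> z"
proof (cases "interior K = {}")
  case True
  then obtain n b where n: "n \<noteq> 0" "K \<subseteq> {x. n \<bullet> x = b}"
    using empty_interior_subset_hyperplane[OF \<open>convex K\<close>] by metis
  have "n \<bullet> y = b" if "y \<in> K" for y
    using subsetD[OF n(2) that] by simp
  then show thesis using that[OF n(1)] \<open>z \<in> K\<close> by simp
next
  case False
  then have "z \<notin> rel_interior K"
    using assms by (simp add: rel_interior_nonempty_interior)
  then obtain n where "n \<noteq> 0" "\<And>y. y \<in> K \<Longrightarrow> n \<bullet> z \<le> n \<bullet> y"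
    using supporting_hyperplane_rel_boundary assms by metis
  then show thesis using that[of "- n"] by auto
qed

text \<open>
A boundary point of the hull maximizes some linear functional, and by \<open>unique_max\<close> such a maximizer
is a single point of \<open>S\<close>. Hence the boundary lies in \<open>S\<close>, and no boundary point lies between two
points of the hull. The latter also makes the interior nonempty as soon as \<open>S\<close> has two points.
\<close>

lemma strictly_convex_hull_of_exposed_set:
  fixes S :: "(real ^ 2) set"
  assumes "compact S" and two: "x1 \<in> S" "x2 \<in> S" "x1 \<noteq> x2"
    and unique_max: "\<And>n. n \<noteq> 0 \<Longrightarrow> \<exists>x\<in>S. \<forall>y\<in>S. y \<noteq> x \<longrightarrow> n \<bullet> y < n \<bullet> x"
    and exposed: "\<And>x. x \<in> S \<Longrightarrow> \<exists>n. n \<noteq> 0 \<and> (\<forall>y\<in>S. y \<noteq> x \<longrightarrow> n \<bullet> y < n \<bullet> x)"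
  shows "strictly_convex_body (convex hull S)" and "frontier (convex hull S) = S"
proof -
  define K where "K = convex hull S"
  have "compact K" "convex K" "S \<subseteq> K"
    by (simp_all add: K_def compact_convex_hull \<open>compact S\<close> hull_subset)
  have boundary: "\<exists>n. z \<in> S \<and> (\<forall>y\<in>K. y \<noteq> z \<longrightarrow> n \<bullet> y < n \<bullet> z)"
    if z: "z \<in> K" "z \<notin> interior K" for z
  proof -
    obtain n where n: "n \<noteq> 0" "\<And>y. y \<in> K \<Longrightarrow> n \<bullet> y \<le> n \<bullet> z"
      using convex_support_direction[OF \<open>convex K\<close> z] by blast
    obtain x where x: "x \<in> S" "\<forall>y\<in>S. y \<noteq> x \<longrightarrow> n \<bullet> y < n \<bullet> x"
      using unique_max n(1) by blast
    then have max: "\<And>y. y \<in> K \<Longrightarrow> y \<noteq> x \<Longrightarrow> n \<bullet> y < n \<bullet> x"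
      unfolding K_def using convex_hull_unique_maximum by blast
    then have "z = x" using n(2)[of x] x(1) z(1) \<open>S \<subseteq> K\<close> by force
    then show ?thesis using x max by blast
  qed
  have segment: "open_segment x y \<subseteq> interior K" if xy: "x \<in> K" "y \<in> K" "x \<noteq> y" for x y
  proof
    fix z assume z: "z \<in> open_segment x y"
    then obtain u where u: "0 < u" "u < 1" "z = (1 - u) *\<^sub>R x + u *\<^sub>R y"
      by (auto simp: in_segment)
    have "z \<in> K" using z xy \<open>convex K\<close> by (meson convex_contains_open_segment subsetD)
    show "z \<in> interior K"
    proof (rule ccontr)
      assume "z \<notin> interior K"
      then obtain n where n: "\<And>y. y \<in> K \<Longrightarrow> y \<noteq> z \<Longrightarrow> n \<bullet> y < n \<bullet> z"
        using boundary \<open>z \<in> K\<close> by blast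
      have "x \<noteq> z" "y \<noteq> z" using z by (auto simp: open_segment_def)
      then have "(1 - u) * (n \<bullet> x) + u * (n \<bullet> y) < (1 - u) * (n \<bullet> z) + u * (n \<bullet> z)"
        using u xy n by (intro add_strict_mono mult_strict_left_mono) auto
      moreover have "n \<bullet> z = (1 - u) * (n \<bullet> x) + u * (n \<bullet> y)"
        by (simp add: u(3) inner_add_right)
      ultimately show False by (simp add: algebra_simps)
    qed
  qed
  have "open_segment x1 x2 \<noteq> {}" using two by simp
  then have "interior K \<noteq> {}" using segment two \<open>S \<subseteq> K\<close> by blast
  then show "strictly_convex_body (convex hull S)"
    using segment \<open>compact K\<close> \<open>convex K\<close> by (auto simp: strictly_convex_body_def K_def)
  have "S \<inter> interior K = {}"
  proof (rule ccontr)
    assume "S \<inter> interior K \<noteq> {}"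
    then obtain x where "x \<in> S" "x \<in> interior K" by blast
    then obtain e where e: "e > 0" "ball x e \<subseteq> K" by (auto simp: mem_interior)
    obtain n where n: "n \<noteq> 0" "\<forall>y\<in>S. y \<noteq> x \<longrightarrow> n \<bullet> y < n \<bullet> x"
      using exposed[OF \<open>x \<in> S\<close>] by blast
    \<comment> \<open>A short step from an interior point in the exposing direction stays in the hull but rises
      above the maximum.\<close>
    define d where "d = e / (2 * norm n)"
    have "d > 0" using e n by (simp add: d_def)
    have "x + d *\<^sub>R n \<in> ball x e" using e n by (simp add: d_def dist_norm)
    then have "x + d *\<^sub>R n \<in> convex hull S" using e by (auto simp: K_def)
    then have "n \<bullet> (x + d *\<^sub>R n) < n \<bullet> x"
      using convex_hull_unique_maximum[of S x n "x + d *\<^sub>R n"] n \<open>d > 0\<close> by auto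
    moreover have "n \<bullet> n > 0" using n by simp
    ultimately show False using \<open>d > 0\<close> by (simp add: inner_add_right mult_less_0_iff)
  qed
  moreover have "frontier K = K - interior K"
    using \<open>compact K\<close> by (simp add: frontier_def compact_imp_closed)
  ultimately show "frontier (convex hull S) = S"
    using boundary \<open>S \<subseteq> K\<close> unfolding K_def by blast
qed

text \<open>
The height of the curve in direction \<open>e_r \<theta>\<close> has the derivative \<open>\<rho> \<sigma> * sin (\<theta> - \<sigma>)\<close> in \<open>\<sigma>\<close>, so
along one period around \<open>\<theta>\<close> it increases up to \<open>\<theta>\<close> and decreases afterwards. So \<open>\<gamma> \<theta>\<close> is the
only highest point of the curve in this direction. This one fact gives injectivity on a period, and
it lets the convex hull of the curve serve as the strictly convex body.
\<close>

theorem strictly_convex_curve_of_normal_angle: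
  fixes \<gamma> :: "real \<Rightarrow> real ^ 2"
  assumes deriv: "\<And>\<theta>. (\<gamma> has_vector_derivative \<rho> \<theta> *\<^sub>R e_theta \<theta>) (at \<theta>)"
    and pos: "\<And>\<theta>. \<rho> \<theta> > 0"
    and periodic: "\<And>\<theta>. \<gamma> (\<theta> + 2 * pi) = \<gamma> \<theta>"
  shows "simple_closed_curve \<gamma>" and "strictly_convex_curve \<gamma>"
proof -
  interpret periodic_fun_simple \<gamma> "2 * pi"
    by unfold_locales (rule periodic)
  have cont: "continuous_on A \<gamma>" for A
    by (meson deriv continuous_at_imp_continuous_on has_vector_derivative_continuous)
  have height_deriv: "((\<lambda>\<sigma>. e_r \<theta> \<bullet> \<gamma> \<sigma>) has_real_derivative \<rho> \<sigma> * sin (\<theta> - \<sigma>)) (at \<sigma>)" for \<theta> \<sigma>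
    using bounded_linear.has_vector_derivative[OF bounded_linear_inner_right deriv, of "e_r \<theta>" \<sigma>]
    by (simp add: has_real_derivative_iff_has_vector_derivative inner_e_theta_e_r
        inner_commute[of "e_r \<theta>" "e_theta \<sigma>"])
  have height_cont: "continuous_on A (\<lambda>\<sigma>. e_r \<theta> \<bullet> \<gamma> \<sigma>)" for A \<theta>
    by (intro continuous_intros cont)
  have below_near: "e_r \<theta> \<bullet> \<gamma> \<sigma> < e_r \<theta> \<bullet> \<gamma> \<theta>" if "\<theta> - pi \<le> \<sigma>" "\<sigma> \<le> \<theta> + pi" "\<sigma> \<noteq> \<theta>" for \<theta> \<sigma>
  proof (cases "\<sigma> < \<theta>")
    case True
    show ?thesis
    proof (rule DERIV_pos_imp_increasing_open[OF True _ height_cont])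
      fix x assume "\<sigma> < x" "x < \<theta>"
      then have "sin (\<theta> - x) > 0" using that by (intro sin_gt_zero) auto
      then show "\<exists>y. ((\<lambda>\<sigma>. e_r \<theta> \<bullet> \<gamma> \<sigma>) has_real_derivative y) (at x) \<and> 0 < y"
        using height_deriv pos by (meson mult_pos_pos)
    qed
  next
    case False
    then have "\<theta> < \<sigma>" using that by simp
    then show ?thesis
    proof (rule DERIV_neg_imp_decreasing_open[OF _ _ height_cont])
      fix x assume "\<theta> < x" "x < \<sigma>"
      then have "sin (x - \<theta>) > 0" using that by (intro sin_gt_zero) auto
      then have "sin (\<theta> - x) < 0" using sin_minus[of "x - \<theta>"] by simp
      then show "\<exists>y. ((\<lambda>\<sigma>. e_r \<theta> \<bullet> \<gamma> \<sigma>) has_real_derivative y) (at x) \<and> y < 0"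
        using height_deriv pos by (meson mult_pos_neg)
    qed
  qed
  have reduce: "\<exists>\<sigma>'. \<theta> - pi \<le> \<sigma>' \<and> \<sigma>' \<le> \<theta> + pi \<and> \<gamma> \<sigma>' = \<gamma> \<sigma>" for \<theta> \<sigma>
    using periodic_representative[of "2 * pi" \<gamma> "\<theta> - pi" \<sigma>] periodic by auto
  have below: "e_r \<theta> \<bullet> y < e_r \<theta> \<bullet> \<gamma> \<theta>" if "y \<in> range \<gamma>" "y \<noteq> \<gamma> \<theta>" for \<theta> y
    using that reduce[of \<theta>] below_near[of \<theta>] by (metis imageE)
  have inj: "inj_on \<gamma> {0..<2 * pi}"
  proof (rule linorder_inj_onI)
    fix x y assume xy: "x < y" "x \<in> {0..<2 * pi}" "y \<in> {0..<2 * pi}"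
    show "\<gamma> x \<noteq> \<gamma> y"
    proof (cases "y \<le> x + pi")
      case True
      then show ?thesis using below_near[of x y] xy by auto
    next
      case False
      \<comment> \<open>More than half a period ahead of \<open>x\<close>, the point of parameter \<open>y\<close> is reached sooner by
        going backwards.\<close>
      then have "e_r x \<bullet> \<gamma> (y - 2 * pi) < e_r x \<bullet> \<gamma> x"
        using xy by (intro below_near) auto
      then show ?thesis using minus_1[of y] by auto
    qed
  qed auto
  show "simple_closed_curve \<gamma>"
    using cont periodic inj by (simp add: simple_closed_curve_def closed_curve_def)
  have "range \<gamma> = \<gamma> ` {- pi..pi}"
    using reduce[of 0] by (auto simp: image_iff) (metis atLeastAtMost_iff)
  then have "compact (range \<gamma>)"
    using compact_continuous_image[OF cont, of "{-pi..pi}"] by simp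
  moreover have "\<gamma> 0 \<noteq> \<gamma> pi" using below_near[of 0 pi] by auto
  moreover have "\<exists>x\<in>range \<gamma>. \<forall>y\<in>range \<gamma>. y \<noteq> x \<longrightarrow> n \<bullet> y < n \<bullet> x" if n: "n \<noteq> 0" for n
  proof -
    obtain r \<theta> where r: "r > 0" "n = r *\<^sub>R e_r \<theta>"
      by (rule polar_direction[OF n])
    then show ?thesis
      using below[of _ \<theta>] by (intro bexI[of _ "\<gamma> \<theta>"]) auto
  qed
  moreover have "\<exists>n. n \<noteq> 0 \<and> (\<forall>y\<in>range \<gamma>. y \<noteq> x \<longrightarrow> n \<bullet> y < n \<bullet> x)" if x: "x \<in> range \<gamma>" for x
  proof -
    obtain \<theta> where \<theta>: "x = \<gamma> \<theta>" using x by (rule rangeE)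
    have "e_r \<theta> \<noteq> 0" using norm_e_r[of \<theta>] by force
    then show ?thesis
      unfolding \<theta> using below[of _ \<theta>] by (intro exI[of _ "e_r \<theta>"]) simp
  qed
  ultimately have "strictly_convex_body (convex hull range \<gamma>)"
    and "frontier (convex hull range \<gamma>) = range \<gamma>"
    using strictly_convex_hull_of_exposed_set[of "range \<gamma>" "\<gamma> 0" "\<gamma> pi"] by simp_all
  then show "strictly_convex_curve \<gamma>"
    unfolding strictly_convex_curve_def by (intro exI[of _ "convex hull range \<gamma>"]) simp
qed

section \<open>Time intervals, and integrals over angle and time\<close>

lemma interval_integrable_continuous:
  fixes f :: "real \<Rightarrow> real"
  assumes "continuous_on {min a b..max a b} f"
  shows "interval_lebesgue_integrable lborel (ereal a) (ereal b) f"
proof (cases "a \<le> b")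
  case True
  then show ?thesis using assms by (intro interval_integrable_continuous_on) auto
next
  case False
  then show ?thesis using assms
    by (subst interval_integrable_endpoints_reverse, intro interval_integrable_continuous_on) auto
qed

lemma LBINT_has_derivative_endpoint:
  fixes f :: "real \<Rightarrow> real"
  assumes "continuous_on UNIV f"
  shows "((\<lambda>x. LBINT y=ereal a..ereal x. f y) has_real_derivative f x) (at x)"
proof -
  define l u where "l = min a x - 1" and "u = max a x + 1"
  have "((\<lambda>x. LBINT y=ereal a..ereal x. f y) has_vector_derivative f x) (at x within {l..u})"
    by (rule interval_integral_FTC2)
      (auto simp: l_def u_def intro: continuous_on_subset[OF assms])
  moreover have "at x within {l..u} = at x"
    by (rule at_within_interior) (auto simp: l_def u_def)
  ultimately show ?thesis by (simp add: has_real_derivative_iff_has_vector_derivative)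
qed

text \<open>
Leibniz' rule for oriented integrals; both orders of the end points occur, since the angle may be
negative.
\<close>

lemma LBINT_has_derivative_parameter:
  fixes f f' :: "real \<Rightarrow> real \<Rightarrow> real"
  assumes "convex J" "t \<in> J"
    and deriv: "\<And>x s. s \<in> J \<Longrightarrow> ((\<lambda>s. f x s) has_real_derivative f' x s) (at s within J)"
    and cont: "\<And>s. s \<in> J \<Longrightarrow> continuous_on UNIV (\<lambda>x. f x s)"
    and cont': "continuous_on (UNIV \<times> J) (\<lambda>(x, s). f' x s)"
  shows "((\<lambda>s. LBINT x=ereal a..ereal b. f x s) has_real_derivative
    (LBINT x=ereal a..ereal b. f' x t)) (at t within J)"
proof -
  have cont'_x: "continuous_on A (\<lambda>x. f' x s)" if "s \<in> J" for s A
    using continuous_on_compose2[OF cont', of A "\<lambda>x. (x, s)"] that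
    by (simp add: continuous_on_Pair image_subset_iff)
  have LBINT_eq: "(LBINT x=ereal a..ereal b. g x) = integral {a..b} g"
    if "a \<le> b" "continuous_on {a..b} g" for a b and g :: "real \<Rightarrow> real"
    using that by (intro interval_integral_eq_integral borel_integrable_atLeastAtMost')
  have main: "((\<lambda>s. LBINT x=ereal a..ereal b. f x s) has_real_derivative
      (LBINT x=ereal a..ereal b. f' x t)) (at t within J)" if "a \<le> b" for a b
  proof -
    have "((\<lambda>s. integral (cbox a b) (\<lambda>x. f x s)) has_real_derivative
        integral (cbox a b) (\<lambda>x. f' x t)) (at t within J)"
    proof (rule leibniz_rule_field_derivative)
      show "continuous_on (J \<times> cbox a b) (\<lambda>(s, x). f' x s)"
        using continuous_on_compose2[OF cont', of "J \<times> cbox a b" "\<lambda>(s, x). (x, s)"]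
        by (simp add: case_prod_unfold continuous_on_Pair continuous_on_fst continuous_on_snd
            image_subset_iff continuous_on_id)
      show "(\<lambda>x. f x s) integrable_on cbox a b" if "s \<in> J" for s
        using continuous_on_subset[OF cont[OF that] subset_UNIV] by (rule integrable_continuous)
    qed (use assms in auto)
    then have "((\<lambda>s. integral {a..b} (\<lambda>x. f x s)) has_real_derivative
        (LBINT x=ereal a..ereal b. f' x t)) (at t within J)"
      by (simp add: LBINT_eq \<open>a \<le> b\<close> cont'_x \<open>t \<in> J\<close>)
    then show ?thesis
      by (rule has_field_derivative_transform_within[OF _ zero_less_one \<open>t \<in> J\<close>])
        (simp add: LBINT_eq \<open>a \<le> b\<close> continuous_on_subset[OF cont])
  qed
  show ?thesis
  proof (cases "a \<le> b")
    case False
    then have "((\<lambda>s. - (LBINT x=ereal b..ereal a. f x s)) has_real_derivative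
        - (LBINT x=ereal b..ereal a. f' x t)) (at t within J)"
      by (intro DERIV_minus main) simp
    then show ?thesis by (simp flip: interval_integral_endpoints_reverse)
  qed (rule main)
qed

lemma time_interval_convex: "convex (time_interval T)"
  unfolding is_interval_convex_1[symmetric] is_interval_1 time_interval_def
  by (auto intro: le_less_trans[rotated] simp flip: ereal_less_eq)

text \<open>
A time interval is open at its end, so near each of its points it agrees with a compact interval.
This reduces statements on the whole interval to compact ones.
\<close>

lemma time_interval_obtain_later:
  assumes "t \<in> time_interval T"
  obtains \<tau> where "0 < \<tau>" "t < \<tau>" "ereal \<tau> < T" "{0..\<tau>} \<subseteq> time_interval T"
    "at t within time_interval T = at t within {0..\<tau>}"
proof -
  obtain \<tau> where \<tau>: "ereal t < ereal \<tau>" "ereal \<tau> < T"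
    using assms ereal_dense2[of "ereal t" T] by (auto simp: time_interval_def)
  have sub: "{0..\<tau>} \<subseteq> time_interval T"
    using \<tau>(2) by (auto simp: time_interval_def intro: le_less_trans[of _ "ereal \<tau>"])
  have "at t within time_interval T = at t within {0..\<tau>}"
    by (rule at_within_nhd[of t "{..<\<tau>}"]) (use \<tau> sub in \<open>auto simp: time_interval_def\<close>)
  then show thesis using that[of \<tau>] \<tau> sub assms by (auto simp: time_interval_def)
qed

lemma time_interval_at_neq_bot:
  assumes "t \<in> time_interval T"
  shows "at t within time_interval T \<noteq> bot"
proof -
  obtain \<tau> where \<tau>: "t < \<tau>" "at t within time_interval T = at t within {0..\<tau>}"
    using time_interval_obtain_later[OF assms] by metis
  have "t islimpt {0..\<tau>}"
    using \<tau>(1) assms by (intro connected_imp_perfect) (auto simp: time_interval_def)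
  then show ?thesis
    using \<tau>(2) by (simp add: trivial_limit_within)
qed

lemma continuous_on_time_interval:
  fixes f :: "'a::t2_space \<times> real \<Rightarrow> 'b::topological_space"
  assumes "\<And>\<tau>. 0 < \<tau> \<Longrightarrow> ereal \<tau> < T \<Longrightarrow> continuous_on (UNIV \<times> {0..\<tau>}) f"
  shows "continuous_on (UNIV \<times> time_interval T) f"
  unfolding continuous_on_eq_continuous_within
proof
  fix z assume z: "z \<in> (UNIV :: 'a set) \<times> time_interval T"
  then obtain \<tau> where \<tau>: "0 < \<tau>" "snd z < \<tau>" "ereal \<tau> < T" "{0..\<tau>} \<subseteq> time_interval T"
    using time_interval_obtain_later[of "snd z" T] by (metis mem_Times_iff)
  have "continuous (at z within (UNIV :: 'a set) \<times> {0..\<tau>}) f"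
    using assms[OF \<tau>(1,3)] z \<tau>(2) unfolding continuous_on_eq_continuous_within
    by (cases z) (simp add: time_interval_def)
  moreover have "at z within (UNIV :: 'a set) \<times> {0..\<tau>} = at z within UNIV \<times> time_interval T"
    by (rule at_within_nhd[of z "UNIV \<times> {..<\<tau>}"])
      (use \<tau> z in \<open>auto simp: time_interval_def mem_Times_iff intro: open_Times\<close>)
  ultimately show "continuous (at z within (UNIV :: 'a set) \<times> time_interval T) f" by simp
qed

lemma LBINT_has_derivative_time:
  fixes f :: "real \<Rightarrow> real"
  assumes cont: "continuous_on (time_interval T) f" and "t \<in> time_interval T"
  shows "((\<lambda>s. LBINT x=ereal 0..ereal s. f x) has_real_derivative f t) (at t within time_interval T)"
proof -
  obtain \<tau> where \<tau>: "t < \<tau>" "{0..\<tau>} \<subseteq> time_interval T"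
      "at t within time_interval T = at t within {0..\<tau>}"
    using time_interval_obtain_later[OF assms(2)] by metis
  have "((\<lambda>s. LBINT x=ereal 0..ereal s. f x) has_vector_derivative f t) (at t within {0..\<tau>})"
    by (rule interval_integral_FTC2[OF _ _ continuous_on_subset[OF cont \<tau>(2)]])
      (use \<tau>(1) assms(2) in \<open>auto simp: time_interval_def\<close>)
  then show ?thesis using \<tau> by (simp add: has_real_derivative_iff_has_vector_derivative)
qed

section \<open>The maximum principle\<close>

lemma global_min_derivatives:
  fixes f f1 :: "real \<Rightarrow> real"
  assumes f: "\<And>x. (f has_real_derivative f1 x) (at x)"
    and f1: "(f1 has_real_derivative f2) (at x)"
    and min: "\<And>y. f x \<le> f y"
  shows "f1 x = 0" and "f2 \<ge> 0"
proof -
  show zero: "f1 x = 0"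
    using DERIV_local_min[OF f, of 1 x] min by simp
  show "f2 \<ge> 0"
  proof (rule ccontr)
    assume "\<not> f2 \<ge> 0"
    then obtain d where d: "d > 0" "\<And>h. h > 0 \<Longrightarrow> h < d \<Longrightarrow> f1 (x + h) < 0"
      using DERIV_neg_dec_right[OF f1] zero by auto
    have "f (x + d / 2) < f x"
    proof (rule DERIV_neg_imp_decreasing_open[of x "x + d / 2" f])
      fix y assume "x < y" "y < x + d / 2"
      then have "f1 y < 0" using d(2)[of "y - x"] d(1) by simp
      then show "\<exists>l. (f has_real_derivative l) (at y) \<and> l < 0" using f by blast
    qed (use d f in \<open>auto intro: DERIV_atLeastAtMost_imp_continuous_on\<close>)
    then show False using min[of "x + d / 2"] by simp
  qed
qed

text \<open>
If \<open>u\<close> ever came down to the level \<open>c\<close>, it would do so for a first time \<open>t1\<close>, at some angle \<open>x1\<close>;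
compactness of a period provides it. There \<open>u\<close> touches \<open>c\<close> at a global minimum in space, so
\<open>touch\<close> makes \<open>u\<close> strictly increasing in time. Then \<open>u\<close> was below \<open>c\<close> just before \<open>t1\<close>,
contrary to the choice of \<open>t1\<close>.
\<close>

lemma lower_barrier:
  fixes u :: "real \<Rightarrow> real \<Rightarrow> real"
  assumes cont: "continuous_on (UNIV \<times> {0..\<tau>}) (\<lambda>(x, t). u x t)"
    and P: "P > 0" and periodic: "\<And>x t. t \<in> {0..\<tau>} \<Longrightarrow> u (x + P) t = u x t"
    and init: "\<And>x. u x 0 > c"
    and touch: "\<And>x t. 0 < t \<Longrightarrow> t \<le> \<tau> \<Longrightarrow> u x t = c \<Longrightarrow> (\<And>y. c \<le> u y t) \<Longrightarrow>
      \<exists>D>0. (u x has_real_derivative D) (at t within {0..\<tau>})"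
    and t: "t \<in> {0..\<tau>}"
  shows "u x t > c"
proof (rule ccontr)
  assume "\<not> u x t > c"
  define A where "A = {z \<in> {0..P} \<times> {0..\<tau>}. (case z of (x, t) \<Rightarrow> u x t) \<le> c}"
  have in_A: "\<exists>y. (y, s) \<in> A" if "u x s \<le> c" "s \<in> {0..\<tau>}" for x s
    using periodic_representative[OF P, of "\<lambda>x. u x s" 0 x] that periodic by (auto simp: A_def)
  have "A \<noteq> {}" using in_A[of x t] \<open>\<not> u x t > c\<close> t by auto
  moreover have "compact A"
  proof -
    have "closed A"
      unfolding A_def
      by (intro continuous_on_closed_Collect_le continuous_on_subset[OF cont] continuous_intros
          closed_Times) auto
    moreover have "bounded A"
      by (rule bounded_subset[of "{0..P} \<times> {0..\<tau>}"]) (auto simp: A_def intro: bounded_Times)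
    ultimately show ?thesis by (simp add: compact_eq_bounded_closed)
  qed
  moreover have "continuous_on A snd" by (intro continuous_intros)
  ultimately obtain z where z: "z \<in> A" "\<forall>w\<in>A. snd z \<le> snd w"
    using continuous_attains_inf by blast
  obtain x1 t1 where zeq: "z = (x1, t1)" by fastforce
  have t1: "t1 \<in> {0..\<tau>}" and le: "u x1 t1 \<le> c" using z by (auto simp: A_def zeq)
  have before: "u y s > c" if "0 \<le> s" "s < t1" for y s
    using in_A[of y s] z(2) that t1 by (force simp: zeq)
  have "t1 > 0" using le init[of x1] t1 by (cases "t1 = 0") auto
  have ge: "u y t1 \<ge> c" for y
  proof -
    have "continuous_on {0..\<tau>} (\<lambda>s. u y s)"
      using continuous_on_compose2[OF cont, of "{0..\<tau>}" "\<lambda>s. (y, s)"]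
      by (simp add: continuous_on_Pair image_subset_iff)
    then have "continuous_on (closure {0..<t1}) (\<lambda>s. u y s)"
      using t1 \<open>t1 > 0\<close> by (auto elim: continuous_on_subset)
    then show ?thesis
      by (rule continuous_ge_on_closure) (use before \<open>t1 > 0\<close> in \<open>auto intro: less_imp_le\<close>)
  qed
  obtain D where "D > 0" "(u x1 has_real_derivative D) (at t1 within {0..\<tau>})"
    using touch[of t1 x1] \<open>t1 > 0\<close> t1 le ge[of x1] ge by force
  then obtain d where d: "d > 0"
      "\<And>h. h > 0 \<Longrightarrow> t1 - h \<in> {0..\<tau>} \<Longrightarrow> h < d \<Longrightarrow> u x1 (t1 - h) < u x1 t1"
    using has_real_derivative_pos_inc_left by blast
  define h where "h = min (d / 2) t1"
  have "h > 0" "h < d" "h \<le> t1" using d(1) \<open>t1 > 0\<close> by (auto simp: h_def)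
  then have "u x1 (t1 - h) < u x1 t1" using d(2)[of h] t1 by auto
  moreover have "u x1 (t1 - h) > c" using before \<open>h > 0\<close> \<open>h \<le> t1\<close> by simp
  ultimately show False using le by simp
qed

text \<open>
At a spatial minimum the gradient term vanishes and the diffusion term is nonnegative; at the
level \<open>c > 0\<close> the linear term is nonnegative too, and the cubic term forces \<open>k\<close> to grow.
\<close>

lemma evolution_keeps_lower_bound:
  fixes A B C k :: "real \<Rightarrow> real \<Rightarrow> real"
  assumes "0 < c"
    and A: "\<And>\<theta> t. t \<in> time_interval T \<Longrightarrow> A \<theta> t \<ge> 0"
    and C: "\<And>\<theta> t. t \<in> time_interval T \<Longrightarrow> C \<theta> t \<ge> 0"
    and k_deriv: "\<And>\<theta> t. t \<in> time_interval T \<Longrightarrow>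
      ((\<lambda>x. k x t) has_real_derivative dtheta k \<theta> t) (at \<theta>)"
    and k'_deriv: "\<And>\<theta> t. t \<in> time_interval T \<Longrightarrow>
      ((\<lambda>x. dtheta k x t) has_real_derivative dtheta (dtheta k) \<theta> t) (at \<theta>)"
    and k_cont: "continuous_on (UNIV \<times> time_interval T) (\<lambda>(\<theta>, t). k \<theta> t)"
    and k_periodic: "\<And>\<theta> t. t \<in> time_interval T \<Longrightarrow> k (\<theta> + 2 * pi) t = k \<theta> t"
    and pde: "\<And>\<theta> t. t \<in> time_interval T \<Longrightarrow> ((\<lambda>s. k \<theta> s) has_real_derivative
        A \<theta> t * (k \<theta> t)^2 * dtheta (dtheta k) \<theta> t + B \<theta> t * (k \<theta> t)^2 * dtheta k \<theta> t
        + (k \<theta> t)^3 + C \<theta> t * k \<theta> t) (at t within time_interval T)"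
    and init: "\<And>\<theta>. k \<theta> 0 > c"
    and t: "t \<in> time_interval T"
  shows "k \<theta> t > c"
proof -
  have sub: "{0..t} \<subseteq> time_interval T"
    using t by (auto simp: time_interval_def intro: le_less_trans[of _ "ereal t"])
  show ?thesis
  proof (rule lower_barrier[where u = k and P = "2 * pi" and \<tau> = t])
    show "continuous_on (UNIV \<times> {0..t}) (\<lambda>(\<theta>, t). k \<theta> t)"
      by (rule continuous_on_subset[OF k_cont]) (use sub in blast)
    show "t \<in> {0..t}" using t by (simp add: time_interval_def)
  next
    fix \<theta> s assume s: "0 < s" "s \<le> t" "k \<theta> s = c" and min: "\<And>y. c \<le> k y s"
    then have sI: "s \<in> time_interval T" using sub by auto
    have k': "dtheta k \<theta> s = 0" and k'': "dtheta (dtheta k) \<theta> s \<ge> 0"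
      using global_min_derivatives[OF k_deriv[OF sI] k'_deriv[OF sI]] min s(3) by auto
    let ?D = "A \<theta> s * (k \<theta> s)^2 * dtheta (dtheta k) \<theta> s + B \<theta> s * (k \<theta> s)^2 * dtheta k \<theta> s
        + (k \<theta> s)^3 + C \<theta> s * k \<theta> s"
    have "0 < (k \<theta> s)^3" using s(3) \<open>0 < c\<close> by simp
    moreover have "0 \<le> A \<theta> s * (k \<theta> s)^2 * dtheta (dtheta k) \<theta> s"
      using A[OF sI] k'' by simp
    moreover have "0 \<le> C \<theta> s * k \<theta> s" using C[OF sI] s(3) \<open>0 < c\<close> by simp
    moreover have "B \<theta> s * (k \<theta> s)^2 * dtheta k \<theta> s = 0" using k' by simp
    ultimately have "?D > 0" by linarith
    moreover have "(k \<theta> has_real_derivative ?D) (at s within {0..t})"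
      by (rule DERIV_subset[OF pde[OF sI] sub])
    ultimately show "\<exists>D>0. (k \<theta> has_real_derivative D) (at s within {0..t})" by blast
  qed (use k_periodic sub init in auto)
qed

lemma continuous_periodic_lower_bound:
  fixes f :: "real \<Rightarrow> real"
  assumes "P > 0" "\<And>x. f (x + P) = f x" "continuous_on UNIV f" "\<And>x. f x > 0"
  obtains c where "0 < c" "\<And>x. f x > c"
proof -
  have "\<exists>x\<in>{0..P}. \<forall>y\<in>{0..P}. f x \<le> f y"
    using assms(1) continuous_on_subset[OF assms(3)] by (intro continuous_attains_inf) auto
  then obtain x where "\<forall>y\<in>{0..P}. f x \<le> f y" by blast
  then have le: "f x \<le> f y" for y
    using periodic_representative[of P f 0 y] assms(1,2) by (metis add_0 atLeastAtMost_iff)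
  have "f y > f x / 2" for y using le[of y] assms(4)[of x] by linarith
  then show thesis using that[of "f x / 2"] assms(4)[of x] by simp
qed

lemma mono_on_has_derivative_nonneg:
  fixes f :: "real \<Rightarrow> real"
  assumes "mono_on S f" "t \<in> S" "(f has_real_derivative D) (at t within S)" "at t within S \<noteq> bot"
  shows "D \<ge> 0"
proof (rule tendsto_lowerbound)
  show "((\<lambda>s. (f s - f t) / (s - t)) \<longlongrightarrow> D) (at t within S)"
    using assms(3) by (simp add: has_field_derivative_iff)
  have "(f s - f t) / (s - t) \<ge> 0" if "s \<in> S" "s \<noteq> t" for s
    using monotone_onD[OF assms(1), of s t] monotone_onD[OF assms(1), of t s] that assms(2)
    by (cases "s < t") (auto intro: divide_nonpos_nonpos divide_nonneg_nonneg)
  then show "\<forall>\<^sub>F s in at t within S. 0 \<le> (f s - f t) / (s - t)"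
    by (auto simp: eventually_at_topological)
qed fact

section \<open>The curves defined by a solution\<close>

lemma dtheta_periodic:
  assumes "\<And>x. f (x + P) t = f x t"
  shows "dtheta f (x + P) t = dtheta f x t"
  unfolding dtheta_def deriv_def DERIV_shift assms ..

text \<open>
The locale collects what the geometry uses of a solution. The evolution equation for \<open>k\<close> enters
only through the resulting equation for the euclidean curvature radius \<open>(a + a'') / k\<close>: its time
derivative is \<open>- ((a k)'' + a k)\<close>, a linear expression in \<open>k\<close> without time derivatives of \<open>a\<close>.
\<close>

locale curvature_flow =
  fixes a k :: "real \<Rightarrow> real \<Rightarrow> real" and T :: ereal
  assumes T_pos: "0 < T"
    and a_deriv: "\<And>\<theta> t. t \<in> time_interval T \<Longrightarrow>
      ((\<lambda>x. a x t) has_real_derivative dtheta a \<theta> t) (at \<theta>)"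
    and a'_deriv: "\<And>\<theta> t. t \<in> time_interval T \<Longrightarrow>
      ((\<lambda>x. dtheta a x t) has_real_derivative dtheta (dtheta a) \<theta> t) (at \<theta>)"
    and a_cont: "continuous_on (UNIV \<times> time_interval T) (\<lambda>(\<theta>, t). a \<theta> t)"
    and a'_cont: "continuous_on (UNIV \<times> time_interval T) (\<lambda>(\<theta>, t). dtheta a \<theta> t)"
    and a''_cont: "continuous_on (UNIV \<times> time_interval T) (\<lambda>(\<theta>, t). dtheta (dtheta a) \<theta> t)"
    and a_pos: "\<And>\<theta> t. t \<in> time_interval T \<Longrightarrow> a \<theta> t > 0"
    and a_convex: "\<And>\<theta> t. t \<in> time_interval T \<Longrightarrow> a \<theta> t + dtheta (dtheta a) \<theta> t > 0"
    and a_periodic: "\<And>\<theta> t. t \<in> time_interval T \<Longrightarrow> a (\<theta> + 2 * pi) t = a \<theta> t"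
    and k_deriv: "\<And>\<theta> t. t \<in> time_interval T \<Longrightarrow>
      ((\<lambda>x. k x t) has_real_derivative dtheta k \<theta> t) (at \<theta>)"
    and k'_deriv: "\<And>\<theta> t. t \<in> time_interval T \<Longrightarrow>
      ((\<lambda>x. dtheta k x t) has_real_derivative dtheta (dtheta k) \<theta> t) (at \<theta>)"
    and k_cont: "continuous_on (UNIV \<times> time_interval T) (\<lambda>(\<theta>, t). k \<theta> t)"
    and k'_cont: "continuous_on (UNIV \<times> time_interval T) (\<lambda>(\<theta>, t). dtheta k \<theta> t)"
    and k''_cont: "continuous_on (UNIV \<times> time_interval T) (\<lambda>(\<theta>, t). dtheta (dtheta k) \<theta> t)"
    and k_pos: "\<And>\<theta> t. t \<in> time_interval T \<Longrightarrow> k \<theta> t > 0"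
    and k_periodic: "\<And>\<theta> t. t \<in> time_interval T \<Longrightarrow> k (\<theta> + 2 * pi) t = k \<theta> t"
    and radius_evolution: "\<And>\<theta> t. t \<in> time_interval T \<Longrightarrow>
      ((\<lambda>s. (a \<theta> s + dtheta (dtheta a) \<theta> s) / k \<theta> s) has_real_derivative
        - (a \<theta> t * dtheta (dtheta k) \<theta> t + 2 * dtheta a \<theta> t * dtheta k \<theta> t
            + (a \<theta> t + dtheta (dtheta a) \<theta> t) * k \<theta> t)) (at t within time_interval T)"
    and initial_sin: "(LBINT \<theta>=ereal 0..ereal (2 * pi).
        (a \<theta> 0 + dtheta (dtheta a) \<theta> 0) / k \<theta> 0 * sin \<theta>) = 0"
    and initial_cos: "(LBINT \<theta>=ereal 0..ereal (2 * pi).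
        (a \<theta> 0 + dtheta (dtheta a) \<theta> 0) / k \<theta> 0 * cos \<theta>) = 0"
begin

abbreviation "I \<equiv> time_interval T"

definition radius :: "real \<Rightarrow> real \<Rightarrow> real" where
  "radius \<theta> t = (a \<theta> t + dtheta (dtheta a) \<theta> t) / k \<theta> t"

text \<open>
The curve moves inwards with the normal velocity \<open>a k\<close>, whose first and second derivatives in the
angle are written out as \<open>speed'\<close> and \<open>speed''\<close>.
\<close>

definition speed :: "real \<Rightarrow> real \<Rightarrow> real" where
  "speed \<theta> t = a \<theta> t * k \<theta> t"

definition speed' :: "real \<Rightarrow> real \<Rightarrow> real" where
  "speed' \<theta> t = a \<theta> t * dtheta k \<theta> t + dtheta a \<theta> t * k \<theta> t"

definition speed'' :: "real \<Rightarrow> real \<Rightarrow> real" where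
  "speed'' \<theta> t = a \<theta> t * dtheta (dtheta k) \<theta> t + 2 * dtheta a \<theta> t * dtheta k \<theta> t
     + dtheta (dtheta a) \<theta> t * k \<theta> t"

lemma zero_in_I: "0 \<in> I"
  using T_pos by (simp add: time_interval_def zero_ereal_def)

lemma radius_pos: "t \<in> I \<Longrightarrow> radius \<theta> t > 0"
  by (simp add: radius_def a_convex k_pos)

lemma speed_deriv:
  assumes "t \<in> I"
  shows "((\<lambda>x. speed x t) has_real_derivative speed' \<theta> t) (at \<theta>)"
  unfolding speed_def speed'_def
  by (auto intro!: derivative_eq_intros a_deriv k_deriv assms)

lemma speed'_deriv:
  assumes "t \<in> I"
  shows "((\<lambda>x. speed' x t) has_real_derivative speed'' \<theta> t) (at \<theta>)"
  unfolding speed'_def speed''_def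
  by (auto intro!: derivative_eq_intros a_deriv a'_deriv k_deriv k'_deriv assms
      simp: algebra_simps)

lemma radius_deriv_time:
  assumes "t \<in> I"
  shows "((\<lambda>s. radius \<theta> s) has_real_derivative - (speed'' \<theta> t + speed \<theta> t)) (at t within I)"
  unfolding radius_def speed''_def speed_def
  by (rule DERIV_cong[OF radius_evolution[OF assms]]) (simp add: algebra_simps)

lemma radius_cont: "continuous_on (UNIV \<times> I) (\<lambda>(\<theta>, t). radius \<theta> t)"
proof -
  have "\<forall>z\<in>UNIV \<times> I. k (fst z) (snd z) \<noteq> 0" using k_pos by (auto simp: less_le)
  then show ?thesis
    using a_cont a''_cont k_cont unfolding radius_def case_prod_unfold
    by (intro continuous_intros)
qed

lemma speed_cont: "continuous_on (UNIV \<times> I) (\<lambda>(\<theta>, t). speed \<theta> t)"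
  using a_cont k_cont unfolding speed_def case_prod_unfold by (intro continuous_intros)

lemma speed'_cont: "continuous_on (UNIV \<times> I) (\<lambda>(\<theta>, t). speed' \<theta> t)"
  using a_cont a'_cont k_cont k'_cont unfolding speed'_def case_prod_unfold
  by (intro continuous_intros)

lemma speed''_cont: "continuous_on (UNIV \<times> I) (\<lambda>(\<theta>, t). speed'' \<theta> t)"
  using a_cont a'_cont a''_cont k_cont k'_cont k''_cont unfolding speed''_def case_prod_unfold
  by (intro continuous_intros)

lemma continuous_in_angle:
  assumes "continuous_on (UNIV \<times> I) (\<lambda>(\<theta>, t). f \<theta> t)" "t \<in> I"
  shows "continuous_on A (\<lambda>\<theta>. f \<theta> t)"
  using continuous_on_compose2[OF assms(1), of A "\<lambda>\<theta>. (\<theta>, t)"] assms(2)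
  by (simp add: continuous_on_Pair image_subset_iff)

lemma continuous_in_time:
  assumes "continuous_on (UNIV \<times> I) (\<lambda>(\<theta>, t). f \<theta> t)" "A \<subseteq> I"
  shows "continuous_on A (\<lambda>t. f \<theta> t)"
  using continuous_on_compose2[OF assms(1), of A "\<lambda>t. (\<theta>, t)"] assms(2)
  by (auto simp: continuous_on_Pair)

lemma speed_periodic: "t \<in> I \<Longrightarrow> speed (\<theta> + 2 * pi) t = speed \<theta> t"
  by (simp add: speed_def a_periodic k_periodic)

lemma speed'_periodic: "t \<in> I \<Longrightarrow> speed' (\<theta> + 2 * pi) t = speed' \<theta> t"
  by (simp add: speed'_def a_periodic k_periodic dtheta_periodic)

lemma radius_periodic: "t \<in> I \<Longrightarrow> radius (\<theta> + 2 * pi) t = radius \<theta> t"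
  by (simp add: radius_def a_periodic k_periodic dtheta_periodic)

text \<open>
For \<open>w\<close> equal to \<open>sin\<close> or \<open>cos\<close> the integrand of the time derivative, \<open>- (speed'' + speed) w\<close>, is
exact: since \<open>w'' = - w\<close>, it is the derivative of \<open>speed w' - speed' w\<close> in the angle.
\<close>

lemma weighted_radius_deriv_time:
  assumes t: "t \<in> I"
    and w: "\<And>x. (w has_real_derivative w' x) (at x)"
    and w': "\<And>x. (w' has_real_derivative - w x) (at x)"
  shows "((\<lambda>s. LBINT \<sigma>=ereal 0..ereal \<theta>. radius \<sigma> s * w \<sigma>) has_real_derivative
    (speed \<theta> t * w' \<theta> - speed' \<theta> t * w \<theta>) - (speed 0 t * w' 0 - speed' 0 t * w 0))
    (at t within I)"
proof -
  have w_cont: "continuous_on A w" for A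
    using w by (meson DERIV_continuous continuous_at_imp_continuous_on)
  have w_cont2: "continuous_on A (\<lambda>z. w (fst z))" for A :: "(real \<times> real) set"
    by (intro continuous_on_compose2[OF w_cont[of UNIV]] continuous_intros) auto
  have "((\<lambda>s. LBINT \<sigma>=ereal 0..ereal \<theta>. radius \<sigma> s * w \<sigma>) has_real_derivative
      (LBINT \<sigma>=ereal 0..ereal \<theta>. - (speed'' \<sigma> t + speed \<sigma> t) * w \<sigma>)) (at t within I)"
  proof (rule LBINT_has_derivative_parameter[OF time_interval_convex t])
    show "((\<lambda>s. radius x s * w x) has_real_derivative - (speed'' x s + speed x s) * w x)
        (at s within I)" if "s \<in> I" for x s
      by (intro DERIV_cmult_right radius_deriv_time that)
    show "continuous_on UNIV (\<lambda>x. radius x s * w x)" if "s \<in> I" for s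
      by (intro continuous_intros continuous_in_angle[OF radius_cont that] w_cont)
    show "continuous_on (UNIV \<times> I) (\<lambda>(x, s). - (speed'' x s + speed x s) * w x)"
      using speed_cont speed''_cont w_cont2 unfolding case_prod_unfold
      by (intro continuous_intros)
  qed
  also have "(LBINT \<sigma>=ereal 0..ereal \<theta>. - (speed'' \<sigma> t + speed \<sigma> t) * w \<sigma>) =
      (speed \<theta> t * w' \<theta> - speed' \<theta> t * w \<theta>) - (speed 0 t * w' 0 - speed' 0 t * w 0)"
  proof (rule interval_integral_FTC_finite)
    show "continuous_on {min 0 \<theta>..max 0 \<theta>} (\<lambda>\<sigma>. - (speed'' \<sigma> t + speed \<sigma> t) * w \<sigma>)"
      by (intro continuous_intros w_cont continuous_in_angle[OF speed''_cont t]
          continuous_in_angle[OF speed_cont t])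
    have "((\<lambda>x. speed x t * w' x - speed' x t * w x) has_real_derivative
        - (speed'' x t + speed x t) * w x) (at x)" for x
      by (auto intro!: derivative_eq_intros w w' speed_deriv[OF t] speed'_deriv[OF t]
          simp: algebra_simps)
    then show "((\<lambda>x. speed x t * w' x - speed' x t * w x) has_vector_derivative
        - (speed'' x t + speed x t) * w x) (at x within A)" for x A
      unfolding has_real_derivative_iff_has_vector_derivative
      by (rule has_vector_derivative_at_within)
  qed
  finally show ?thesis .
qed

text \<open>
Over a full period the boundary terms cancel, so the condition for the curve to close up is
conserved in time.
\<close>

lemma weighted_radius_closed:
  assumes t: "t \<in> I"
    and w: "\<And>x. (w has_real_derivative w' x) (at x)"
    and w': "\<And>x. (w' has_real_derivative - w x) (at x)"
    and "w (2 * pi) = w 0" "w' (2 * pi) = w' 0"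
    and init: "(LBINT \<sigma>=ereal 0..ereal (2 * pi). radius \<sigma> 0 * w \<sigma>) = 0"
  shows "(LBINT \<sigma>=ereal 0..ereal (2 * pi). radius \<sigma> t * w \<sigma>) = 0"
proof -
  have "((\<lambda>s. LBINT \<sigma>=ereal 0..ereal (2 * pi). radius \<sigma> s * w \<sigma>) has_real_derivative 0)
      (at s within I)" if "s \<in> I" for s
    using weighted_radius_deriv_time[OF that w w', of "2 * pi"] assms(4,5)
      speed_periodic[OF that, of 0] speed'_periodic[OF that, of 0] by simp
  then have "\<exists>c. \<forall>s\<in>I. (LBINT \<sigma>=ereal 0..ereal (2 * pi). radius \<sigma> s * w \<sigma>) = c"
    by (rule has_field_derivative_zero_constant[OF time_interval_convex])
  then show ?thesis using init t zero_in_I by fastforce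
qed

lemma weighted_radius_periodic:
  assumes t: "t \<in> I"
    and w: "\<And>x. (w has_real_derivative w' x) (at x)"
    and w': "\<And>x. (w' has_real_derivative - w x) (at x)"
    and per: "\<And>x. w (x + 2 * pi) = w x" "\<And>x. w' (x + 2 * pi) = w' x"
    and init: "(LBINT \<sigma>=ereal 0..ereal (2 * pi). radius \<sigma> 0 * w \<sigma>) = 0"
  shows "(LBINT \<sigma>=ereal 0..ereal (\<theta> + 2 * pi). radius \<sigma> t * w \<sigma>) =
    (LBINT \<sigma>=ereal 0..ereal \<theta>. radius \<sigma> t * w \<sigma>)"
proof -
  define G where "G x = (LBINT \<sigma>=ereal 0..ereal x. radius \<sigma> t * w \<sigma>)" for x
  have G: "(G has_real_derivative radius x t * w x) (at x)" for x
    unfolding G_def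
    by (intro LBINT_has_derivative_endpoint continuous_intros continuous_in_angle[OF radius_cont t])
      (meson w DERIV_continuous continuous_at_imp_continuous_on)
  have "((\<lambda>x. G (x + 2 * pi) - G x) has_real_derivative 0) (at x)" for x
    using DERIV_diff[OF G[of "x + 2 * pi", unfolded DERIV_shift] G[of x]]
    by (simp add: per radius_periodic[OF t])
  then have "G (\<theta> + 2 * pi) - G \<theta> = G (0 + 2 * pi) - G 0"
    using DERIV_isconst_all[of "\<lambda>x. G (x + 2 * pi) - G x" \<theta> 0] by blast
  moreover have "G (2 * pi) = 0"
    unfolding G_def using weighted_radius_closed[OF t w w' _ _ init] per(1)[of 0] per(2)[of 0] by simp
  moreover have "G 0 = 0" unfolding G_def by simp
  ultimately have "G (\<theta> + 2 * pi) = G \<theta>" by simp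
  then show ?thesis unfolding G_def .
qed

lemma F_curve_nth:
  "F_curve a k \<theta> t $ 1 =
    - (LBINT \<sigma>=ereal 0..ereal \<theta>. radius \<sigma> t * sin \<sigma>) - (LBINT s=ereal 0..ereal t. speed 0 s)"
  "F_curve a k \<theta> t $ 2 =
    (LBINT \<sigma>=ereal 0..ereal \<theta>. radius \<sigma> t * cos \<sigma>) - (LBINT s=ereal 0..ereal t. speed' 0 s)"
  by (simp_all add: F_curve_def radius_def speed_def speed'_def)

lemma minus_sin_deriv: "((\<lambda>x. - sin x) has_real_derivative - cos x) (at x)"
  by (auto intro!: derivative_eq_intros)

lemma F_curve_periodic:
  assumes t: "t \<in> I"
  shows "F_curve a k (\<theta> + 2 * pi) t = F_curve a k \<theta> t"
proof -
  have init: "(LBINT \<sigma>=ereal 0..ereal (2 * pi). radius \<sigma> 0 * sin \<sigma>) = 0"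
    "(LBINT \<sigma>=ereal 0..ereal (2 * pi). radius \<sigma> 0 * cos \<sigma>) = 0"
    unfolding radius_def by (rule initial_sin initial_cos)+
  have minus_sin_periodic: "- sin (x + 2 * pi) = - sin x" for x :: real by simp
  note sin = weighted_radius_periodic[OF t DERIV_sin DERIV_cos sin_periodic cos_periodic init(1)]
  note cos = weighted_radius_periodic[OF t DERIV_cos minus_sin_deriv cos_periodic
      minus_sin_periodic init(2)]
  show ?thesis
    unfolding vec2_eq_iff F_curve_nth sin cos by (rule conjI refl)+
qed

lemma F_curve_well_defined:
  assumes t: "t \<in> I"
  shows "F_well_defined a k t"
proof -
  have sub: "{min 0 t..max 0 t} \<subseteq> I"
    using t by (auto simp: time_interval_def intro: le_less_trans[of _ "ereal t"])
  have angle: "interval_lebesgue_integrable lborel (ereal 0) (ereal \<theta>) (\<lambda>\<sigma>. radius \<sigma> t * w \<sigma>)"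
    if "continuous_on UNIV w" for \<theta> and w :: "real \<Rightarrow> real"
    by (intro interval_integrable_continuous continuous_intros continuous_in_angle[OF radius_cont t]
        continuous_on_subset[OF that]) auto
  have time: "interval_lebesgue_integrable lborel (ereal 0) (ereal t) (\<lambda>s. f 0 s)"
    if "continuous_on (UNIV \<times> I) (\<lambda>(\<theta>, t). f \<theta> t)"
    for f :: "real \<Rightarrow> real \<Rightarrow> real"
    by (rule interval_integrable_continuous[OF continuous_in_time[OF that sub]])
  have "k \<theta> t \<noteq> 0" for \<theta> using k_pos[OF t, of \<theta>] by simp
  then show ?thesis
    using angle[of sin] angle[of cos] time[OF speed_cont] time[OF speed'_cont]
      F_curve_periodic[OF t]
    by (simp add: F_well_defined_def radius_def speed_def speed'_def continuous_on_sin
        continuous_on_cos continuous_on_id)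
qed

lemma F_curve_deriv_angle:
  assumes t: "t \<in> I"
  shows "((\<lambda>\<theta>. F_curve a k \<theta> t) has_vector_derivative radius \<theta> t *\<^sub>R e_theta \<theta>) (at \<theta>)"
proof -
  have G: "((\<lambda>x. LBINT \<sigma>=ereal 0..ereal x. radius \<sigma> t * w \<sigma>) has_real_derivative radius \<theta> t * w \<theta>)
      (at \<theta>)" if "continuous_on UNIV w" for w
    by (intro LBINT_has_derivative_endpoint continuous_intros continuous_in_angle[OF radius_cont t] that)
  show ?thesis
    unfolding has_vector_derivative_vec2_iff F_curve_nth
    by (auto intro!: derivative_eq_intros G continuous_intros)
qed

text \<open>
The boundary terms at the angle \<open>0\<close> are cancelled by the time integrals in the definition of the
curve. This is what these integrals are for: they keep track of the motion of the base point.
\<close>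

lemma F_curve_deriv_time:
  assumes t: "t \<in> I"
  shows "((\<lambda>s. F_curve a k \<theta> s) has_vector_derivative
    - speed \<theta> t *\<^sub>R e_r \<theta> - speed' \<theta> t *\<^sub>R e_theta \<theta>) (at t within I)"
proof -
  have "((\<lambda>s. LBINT x=ereal 0..ereal s. f 0 x) has_real_derivative f 0 t) (at t within I)"
    if "continuous_on (UNIV \<times> I) (\<lambda>(\<theta>, t). f \<theta> t)" for f
    by (intro LBINT_has_derivative_time continuous_in_time[OF that] t order_refl)
  note time = this[OF speed_cont] this[OF speed'_cont]
  note angle = weighted_radius_deriv_time[OF t DERIV_sin DERIV_cos, of \<theta>]
    weighted_radius_deriv_time[OF t DERIV_cos minus_sin_deriv, of \<theta>]
  show ?thesis
    unfolding has_vector_derivative_vec2_iff F_curve_nth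
    by (intro conjI DERIV_cong[OF DERIV_diff[OF DERIV_minus[OF angle(1)] time(1)]]
        DERIV_cong[OF DERIV_diff[OF angle(2) time(2)]]) (simp_all add: algebra_simps)
qed

lemma p_deriv_eq:
  assumes t: "t \<in> I"
  shows "p_deriv a \<theta> t = (a \<theta> t + dtheta (dtheta a) \<theta> t) *\<^sub>R e_theta \<theta>"
  unfolding p_deriv_def
proof (rule vector_derivative_at)
  show "((\<lambda>x. p_curve a x t) has_vector_derivative
      (a \<theta> t + dtheta (dtheta a) \<theta> t) *\<^sub>R e_theta \<theta>) (at \<theta>)"
    unfolding has_vector_derivative_vec2_iff p_curve_def
    by (auto intro!: derivative_eq_intros a_deriv[OF t] a'_deriv[OF t] simp: algebra_simps)
qed

lemma bracket_p_eq:
  assumes t: "t \<in> I"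
  shows "bracket (p_curve a \<theta> t) (p_deriv a \<theta> t) = a \<theta> t * (a \<theta> t + dtheta (dtheta a) \<theta> t)"
proof -
  have "bracket (p_curve a \<theta> t) (p_deriv a \<theta> t) =
      (a \<theta> t * cos \<theta> - dtheta a \<theta> t * sin \<theta>) * ((a \<theta> t + dtheta (dtheta a) \<theta> t) * cos \<theta>)
      + (a \<theta> t * sin \<theta> + dtheta a \<theta> t * cos \<theta>) * ((a \<theta> t + dtheta (dtheta a) \<theta> t) * sin \<theta>)"
    unfolding p_deriv_eq[OF t] by (simp add: bracket_eq p_curve_def)
  also have "\<dots> = a \<theta> t * (a \<theta> t + dtheta (dtheta a) \<theta> t)"
    using sin_cos_squared_add[of \<theta>] by algebra
  finally show ?thesis .
qed

lemma q_curve_eq: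
  assumes t: "t \<in> I"
  shows "q_curve a \<theta> t = (1 / a \<theta> t) *\<^sub>R e_theta \<theta>"
  using a_convex[OF t, of \<theta>] 
  unfolding q_curve_def bracket_p_eq[OF t] unfolding p_deriv_eq[OF t] by simp

lemma F_curve_parameterized_as_usual:
  assumes t: "t \<in> I"
  shows "parameterized_as_usual (\<lambda>\<theta>. F_curve a k \<theta> t)"
proof -
  have "e_theta \<theta> = vector [cos (\<theta> + pi / 2), sin (\<theta> + pi / 2)]" for \<theta>
    by (simp add: vec2_eq_iff cos_add sin_add)
  then show ?thesis
    using F_curve_deriv_angle[OF t] radius_pos[OF t] by (auto simp: parameterized_as_usual_def)
qed

lemma F_curve_minkowskian_curvature:
  assumes t: "t \<in> I"
  shows "has_minkowskian_curvature a t (\<lambda>\<theta>. F_curve a k \<theta> t) \<theta> (k \<theta> t)"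
proof -
  have pos: "a \<theta> t > 0" "k \<theta> t > 0" "a \<theta> t + dtheta (dtheta a) \<theta> t > 0"
    using a_pos k_pos a_convex t by auto
  have "k \<theta> t = bracket (p_curve a \<theta> t) (p_deriv a \<theta> t) / (a \<theta> t * radius \<theta> t)"
    using pos by (simp add: bracket_p_eq[OF t] radius_def)
  moreover have "a \<theta> t * radius \<theta> t > 0" using pos(1) radius_pos[OF t] by simp
  moreover have "(a \<theta> t * radius \<theta> t) *\<^sub>R q_curve a \<theta> t = radius \<theta> t *\<^sub>R e_theta \<theta>"
    using pos by (simp add: q_curve_eq[OF t])
  ultimately show ?thesis
    unfolding has_minkowskian_curvature_def using F_curve_deriv_angle[OF t, of \<theta>]
    by (intro exI[of _ "a \<theta> t * radius \<theta> t"]) simp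
qed

lemma F_curve_evolution:
  assumes t: "t \<in> I"
  shows "((\<lambda>s. F_curve a k \<theta> s) has_vector_derivative
    (- k \<theta> t) *\<^sub>R p_curve a \<theta> t - ((a \<theta> t)\<^sup>2 * dtheta k \<theta> t) *\<^sub>R q_curve a \<theta> t) (at t within I)"
proof -
  have "(- k \<theta> t) *\<^sub>R p_curve a \<theta> t - ((a \<theta> t)\<^sup>2 * dtheta k \<theta> t) *\<^sub>R q_curve a \<theta> t =
      - speed \<theta> t *\<^sub>R e_r \<theta> - speed' \<theta> t *\<^sub>R e_theta \<theta>"
    using a_pos[OF t, of \<theta>]
    by (simp add: q_curve_eq[OF t] p_curve_def speed_def speed'_def vec2_eq_iff power2_eq_square
        algebra_simps)
  then show ?thesis using F_curve_deriv_time[OF t] by simp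
qed

end

section \<open>From the evolution equation to the curves\<close>

lemma has_derivative_dtheta:
  assumes "(\<lambda>x. f x t) differentiable (at \<theta>)"
  shows "((\<lambda>x. f x t) has_real_derivative dtheta f \<theta> t) (at \<theta>)"
  using assms unfolding dtheta_def
  by (simp add: DERIV_deriv_iff_real_differentiable)

theorem theorem2p1:
  fixes a k :: "real \<Rightarrow> real \<Rightarrow> real" and \<phi> :: "real \<Rightarrow> real"
    and T T0 :: ereal and \<alpha> :: real
  assumes "0 < T0" and "T0 \<le> T" and "0 < \<alpha>" and "\<alpha> \<le> 1"
    and a_smooth: "smooth_on_time (time_interval T) a"
    and a_pos: "\<And>\<theta> t. t \<in> time_interval T \<Longrightarrow> a \<theta> t > 0"
    and a_periodic: "\<And>\<theta> t. t \<in> time_interval T \<Longrightarrow> a (\<theta> + pi) t = a \<theta> t"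
    and a_convex: "\<And>\<theta> t. t \<in> time_interval T \<Longrightarrow> a \<theta> t + dtheta (dtheta a) \<theta> t > 0"
    and a_mono: "\<And>\<theta>. mono_on (time_interval T) (\<lambda>t. a \<theta> t + dtheta (dtheta a) \<theta> t)"
    and k_periodic: "\<And>\<theta> t. t \<in> time_interval T0 \<Longrightarrow> k (\<theta> + 2 * pi) t = k \<theta> t"
    and k_class: "\<And>\<tau>. 0 < \<tau> \<Longrightarrow> ereal \<tau> < T0 \<Longrightarrow> holder_C2_C1 \<alpha> {0..\<tau>} k"
    and k_pde: "\<And>\<theta> t. t \<in> time_interval T0 \<Longrightarrow>
      ((\<lambda>s. k \<theta> s) has_real_derivative
         a \<theta> t / (a \<theta> t + dtheta (dtheta a) \<theta> t) * (k \<theta> t)^2 * dtheta (dtheta k) \<theta> t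
         + 2 * dtheta a \<theta> t / (a \<theta> t + dtheta (dtheta a) \<theta> t) * (k \<theta> t)^2 * dtheta k \<theta> t
         + (k \<theta> t)^3
         + dtime (time_interval T) (\<lambda>x s. ln (a x s + dtheta (dtheta a) x s)) \<theta> t * k \<theta> t)
      (at t within time_interval T0)"
    and k_init: "\<And>\<theta>. k \<theta> 0 = \<phi> \<theta>"
    and phi_periodic: "\<And>\<theta>. \<phi> (\<theta> + 2 * pi) = \<phi> \<theta>"
    and phi_pos: "\<And>\<theta>. \<phi> \<theta> > 0"
    and phi_class: "holder_C1 \<alpha> \<phi>"
    and phi_sin: "(LBINT \<theta>=ereal 0..ereal (2 * pi).
        (a \<theta> 0 + dtheta (dtheta a) \<theta> 0) / \<phi> \<theta> * sin \<theta>) = 0"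
    and phi_cos: "(LBINT \<theta>=ereal 0..ereal (2 * pi).
        (a \<theta> 0 + dtheta (dtheta a) \<theta> 0) / \<phi> \<theta> * cos \<theta>) = 0"
  shows "\<forall>t\<in>time_interval T0.
      F_well_defined a k t \<and>
      (simple_closed_curve (\<lambda>\<theta>. F_curve a k \<theta> t) \<and>
       strictly_convex_curve (\<lambda>\<theta>. F_curve a k \<theta> t) \<and>
       parameterized_as_usual (\<lambda>\<theta>. F_curve a k \<theta> t) \<and>
       (\<forall>\<theta>. has_minkowskian_curvature a t (\<lambda>\<theta>. F_curve a k \<theta> t) \<theta> (k \<theta> t))) \<and>
      (\<forall>\<theta>. ((\<lambda>s. F_curve a k \<theta> s) has_vector_derivative
         (- k \<theta> t) *\<^sub>R p_curve a \<theta> t - ((a \<theta> t)^2 * dtheta k \<theta> t) *\<^sub>R q_curve a \<theta> t)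
         (at t within time_interval T0))"
proof -
  define g where "g \<theta> t = a \<theta> t + dtheta (dtheta a) \<theta> t" for \<theta> t
  define L where "L = dtime (time_interval T) (\<lambda>x s. ln (a x s + dtheta (dtheta a) x s))"
  have sub: "time_interval T0 \<subseteq> time_interval T"
    using \<open>T0 \<le> T\<close> by (auto simp: time_interval_def)
  have "C_on 3 (time_interval T) a" using a_smooth by (simp add: smooth_on_time_def)
  note a_reg = this[unfolded numeral_3_eq_3 C_on.simps]
  have a_deriv: "((\<lambda>x. a x t) has_real_derivative dtheta a \<theta> t) (at \<theta>)"
    and a'_deriv: "((\<lambda>x. dtheta a x t) has_real_derivative dtheta (dtheta a) \<theta> t) (at \<theta>)"
    if "t \<in> time_interval T0" for \<theta> t
    using a_reg that sub by (auto intro!: has_derivative_dtheta)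
  have restrict: "continuous_on (UNIV \<times> time_interval T0) f"
    if "continuous_on (UNIV \<times> time_interval T) f" for f :: "real \<times> real \<Rightarrow> real"
    by (rule continuous_on_subset[OF that]) (use sub in blast)
  have g_pos: "g \<theta> t > 0" if "t \<in> time_interval T0" for \<theta> t
    using a_convex sub that by (auto simp: g_def)
  have g_time: "((\<lambda>s. g \<theta> s) has_real_derivative L \<theta> t * g \<theta> t) (at t within time_interval T)"
    if t: "t \<in> time_interval T" for \<theta> t
  proof -
    have "(\<lambda>s. a \<theta> s) differentiable (at t within time_interval T)"
      "(\<lambda>s. dtheta (dtheta a) \<theta> s) differentiable (at t within time_interval T)"
      using a_reg t by auto
    then have "(\<lambda>s. g \<theta> s) differentiable (at t within time_interval T)"
      unfolding g_def by (rule differentiable_add)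
    then obtain D where D: "((\<lambda>s. g \<theta> s) has_real_derivative D) (at t within time_interval T)"
      by (auto simp: real_differentiable_def)
    have pos: "g \<theta> t > 0" using a_convex[OF t] by (simp add: g_def)
    have "((\<lambda>s. ln (g \<theta> s)) has_real_derivative D / g \<theta> t) (at t within time_interval T)"
      using D pos by (auto intro!: derivative_eq_intros)
    then have "L \<theta> t = D / g \<theta> t"
      unfolding L_def dtime_def g_def has_real_derivative_iff_has_vector_derivative
      by (rule vector_derivative_within[OF time_interval_at_neq_bot[OF t]])
    then show ?thesis using D pos by simp
  qed
  \<comment> \<open>This is where the monotonicity of \<open>a + a''\<close> in time enters: it gives the zeroth order term the
    sign that the maximum principle needs.\<close>
  have L_nonneg: "L \<theta> t \<ge> 0" if t: "t \<in> time_interval T0" for \<theta> t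
  proof -
    have tT: "t \<in> time_interval T" using t sub by blast
    have "mono_on (time_interval T) (\<lambda>s. g \<theta> s)" using a_mono by (simp add: g_def)
    then have "L \<theta> t * g \<theta> t \<ge> 0"
      by (rule mono_on_has_derivative_nonneg[OF _ tT g_time[OF tT] time_interval_at_neq_bot[OF tT]])
    then show ?thesis using g_pos[OF t, of \<theta>] by (simp add: zero_le_mult_iff)
  qed
  have k_deriv: "((\<lambda>x. k x t) has_real_derivative dtheta k \<theta> t) (at \<theta>)"
    and k'_deriv: "((\<lambda>x. dtheta k x t) has_real_derivative dtheta (dtheta k) \<theta> t) (at \<theta>)"
    if t: "t \<in> time_interval T0" for \<theta> t
  proof -
    obtain \<tau> where \<tau>: "0 < \<tau>" "t < \<tau>" "ereal \<tau> < T0"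
      using time_interval_obtain_later[OF t] by metis
    have "t \<in> {0..\<tau>}" using t \<tau> by (simp add: time_interval_def)
    then have "(\<lambda>x. k x t) differentiable (at \<theta>)" "(\<lambda>x. dtheta k x t) differentiable (at \<theta>)"
      using k_class[OF \<tau>(1,3)] unfolding holder_C2_C1_def by blast+
    then show "((\<lambda>x. k x t) has_real_derivative dtheta k \<theta> t) (at \<theta>)"
      "((\<lambda>x. dtheta k x t) has_real_derivative dtheta (dtheta k) \<theta> t) (at \<theta>)"
      by (simp_all add: has_derivative_dtheta)
  qed
  have k_cont: "continuous_on (UNIV \<times> time_interval T0) (\<lambda>(\<theta>, t). k \<theta> t)"
    "continuous_on (UNIV \<times> time_interval T0) (\<lambda>(\<theta>, t). dtheta k \<theta> t)"
    "continuous_on (UNIV \<times> time_interval T0) (\<lambda>(\<theta>, t). dtheta (dtheta k) \<theta> t)"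
    using k_class by (auto simp: holder_C2_C1_def intro!: continuous_on_time_interval)
  have k_time: "((\<lambda>s. k \<theta> s) has_real_derivative
      a \<theta> t / g \<theta> t * (k \<theta> t)^2 * dtheta (dtheta k) \<theta> t
      + 2 * dtheta a \<theta> t / g \<theta> t * (k \<theta> t)^2 * dtheta k \<theta> t + (k \<theta> t)^3 + L \<theta> t * k \<theta> t)
      (at t within time_interval T0)" if "t \<in> time_interval T0" for \<theta> t
    using k_pde[OF that] by (simp add: g_def L_def)
  have "continuous_on UNIV \<phi>"
    using phi_class by (auto simp: holder_C1_def continuous_on_eq_continuous_within
        intro: differentiable_imp_continuous_within)
  then obtain c where c: "0 < c" "\<And>\<theta>. \<phi> \<theta> > c"
    using continuous_periodic_lower_bound[of "2 * pi" \<phi>] phi_periodic phi_pos by auto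
  have k_pos: "k \<theta> t > 0" if t: "t \<in> time_interval T0" for \<theta> t
  proof -
    have "k \<theta> t > c"
    proof (rule evolution_keeps_lower_bound[OF c(1) _ L_nonneg k_deriv k'_deriv k_cont(1)
          k_periodic k_time _ t])
      show "a \<theta> t / g \<theta> t \<ge> 0" if "t \<in> time_interval T0" for \<theta> t
        using a_pos[of t \<theta>] g_pos[OF that, of \<theta>] that sub by (auto intro: less_imp_le)
      show "k \<theta> 0 > c" for \<theta> by (simp add: k_init c(2))
    qed
    then show ?thesis using c(1) by simp
  qed
  \<comment> \<open>The term \<open>L k\<close> in the equation for \<open>k\<close> cancels the time derivative of \<open>g\<close>, and the factor
    \<open>k\<^sup>2\<close> cancels the square of the denominator.\<close>
  have radius: "((\<lambda>s. g \<theta> s / k \<theta> s) has_real_derivative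
      - (a \<theta> t * dtheta (dtheta k) \<theta> t + 2 * dtheta a \<theta> t * dtheta k \<theta> t + g \<theta> t * k \<theta> t))
      (at t within time_interval T0)" if t: "t \<in> time_interval T0" for \<theta> t
  proof -
    have pos: "k \<theta> t \<noteq> 0" "g \<theta> t \<noteq> 0" using k_pos[OF t, of \<theta>] g_pos[OF t, of \<theta>] by auto
    have "((\<lambda>s. g \<theta> s) has_real_derivative L \<theta> t * g \<theta> t) (at t within time_interval T0)"
      using DERIV_subset[OF g_time sub] t sub by blast
    from DERIV_divide[OF this k_time[OF t] pos(1)] show ?thesis
      by (rule DERIV_cong)
        (use pos in \<open>simp add: field_simps power2_eq_square power3_eq_cube\<close>)
  qed
  interpret curvature_flow a k T0
  proof
    show "a (\<theta> + 2 * pi) t = a \<theta> t" if "t \<in> time_interval T0" for \<theta> t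
      using a_periodic[of t "\<theta> + pi"] a_periodic[of t \<theta>] that sub by (simp add: subset_iff add.assoc)
    show "continuous_on (UNIV \<times> time_interval T0) (\<lambda>(\<theta>, t). a \<theta> t)"
      "continuous_on (UNIV \<times> time_interval T0) (\<lambda>(\<theta>, t). dtheta a \<theta> t)"
      "continuous_on (UNIV \<times> time_interval T0) (\<lambda>(\<theta>, t). dtheta (dtheta a) \<theta> t)"
      using a_reg by (auto intro: restrict)
    show "(LBINT \<theta>=ereal 0..ereal (2 * pi).
        (a \<theta> 0 + dtheta (dtheta a) \<theta> 0) / k \<theta> 0 * sin \<theta>) = 0"
      "(LBINT \<theta>=ereal 0..ereal (2 * pi).
        (a \<theta> 0 + dtheta (dtheta a) \<theta> 0) / k \<theta> 0 * cos \<theta>) = 0"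
      unfolding k_init by (rule phi_sin phi_cos)+
  qed (use assms(1) a_deriv a'_deriv a_pos a_convex sub k_deriv k'_deriv k_cont k_pos k_periodic
      radius[unfolded g_def] in \<open>blast+\<close>)
  show ?thesis
  proof (intro ballI conjI allI)
    fix t assume t: "t \<in> time_interval T0"
    show "simple_closed_curve (\<lambda>\<theta>. F_curve a k \<theta> t)" "strictly_convex_curve (\<lambda>\<theta>. F_curve a k \<theta> t)"
      by (rule strictly_convex_curve_of_normal_angle[OF F_curve_deriv_angle[OF t] radius_pos[OF t]
            F_curve_periodic[OF t]])+
  qed (rule F_curve_well_defined F_curve_parameterized_as_usual F_curve_minkowskian_curvature
      F_curve_evolution, assumption)+
qed

end
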